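(* Let $\mathsf{TFAG}$ be the quasivariety of torsion-free Abelian groups, let $\mathcal F=\{f_n:n\in\mathbb Z^+\}$, where $f_n$ is the unary implicit operation of $\mathsf{TFAG}$ of "dividing by $n$" (defined by the equation $x\approx ny$), let $\mathscr L_{\mathcal F}=\{+,-,0\}\cup\{d_n:n\in\mathbb Z^+\}$ be the $\mathcal F$-expansion in which $d_n$ is the symbol for $f_n$, and let $\mathsf{DAG}=\mathbb S(\mathsf{TFAG}[\mathscr L_{\mathcal F}])$. Then $\mathsf{DAG}$ is a variety and an equational Beth companion of $\mathsf{TFAG}$.
   Context: An Abelian group $\langle A;+,-,0\rangle$ is torsion-free when $0$ is its only element of finite order. For $\mathbf A\in\mathsf{TFAG}$, $f_n^{\mathbf A}$ has domain $\{c\in A:nb=c\text{ for some }b\in A\}$ and maps $c$ to the unique $b$ with $nb=c$. Algebras are nonempty structures in a language with function symbols (including constants) only; a class of algebras $\mathsf K$ consists of algebras in a common language $\mathscr L_{\mathsf K}$; ${\upharpoonright}_{\mathscr L}$ denotes reducts to $\mathscr L$. Formulas are first-order formulas with equality. A pp formula is one of the form $\exists x_1,\dots,x_k\,\varphi$ with $\varphi$ a finite conjunction of equations (the empty one being $\top$). A variety is a class closed under homomorphic images, subalgebras, and direct products. Implicit operations. An $n$-ary partial function on a class $\mathsf{K}$ is a sequence $f=\langle f^{\mathbf A}:\mathbf A\in\mathsf K\rangle$ where each $f^{\mathbf A}$ is a function from a subset $\mathrm{dom}(f^{\mathbf A})\subseteq A^n$ to $A$. A formula $\varphi(x_1,\dots,x_n,y)$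 with $n\ge 1$ is functional in $\mathsf K$ when for all $\mathbf A\in\mathsf K$ and $a_1,\dots,a_n\in A$ there is at most one $b\in A$ with $\mathbf A\vDash\varphi(a_1,\dots,a_n,b)$; it then defines the partial function whose $\mathbf A$-component is defined exactly at the tuples for which such a $b$ exists, with value $b$. An implicit operation of $\mathsf K$ is a partial function $f$ on $\mathsf K$ that is defined by some formula functional in $\mathsf K$ and is preserved by homomorphisms: for every homomorphism $h\colon\mathbf A\to\mathbf B$ with $\mathbf A,\mathbf B\in\mathsf K$ and $\vec a\in\mathrm{dom}(f^{\mathbf A})$ we have $h(\vec a)\in\mathrm{dom}(f^{\mathbf B})$ and $h(f^{\mathbf A}(\vec a))=f^{\mathbf B}(h(\vec a))$. It is extendable when for all $\mathbf A\in\mathsf K$ and $\vec a\in A^n$ there is $\mathbf B\in\mathsf K$ with $\mathbf A\le\mathbf B$ and $\vec a\in\mathrm{dom}(f^{\mathbf B})$. $\mathrm{ext}_{pp}(\mathsf K)$ (resp. $\mathrm{ext}_{eq}(\mathsf K)$) is the set of extendable implicit operations of $\mathsf K$ defined by pp formulas (resp. by conjunctions of equations). pp expansions and Beth companions. For $\mathcal F\subseteq\mathrm{ext}_{pp}(\mathsf K)$, an $\mathcal F$-expansion of $\mathscr L_{\mathsf K}$ is a language $\mathscr L_{\mathcal F}=\mathscr L_{\mathsf K}\cup\{g_f:f\in\mathcal F\}$ where $g_f$ is a new function symbol of the same arity as $f$. For $\mathbf A\in\mathsf K$ with $f^{\mathbf A}$ total for all $f\in\mathcal F$, $\mathbf A[\mathscr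 L_{\mathcal F}]$ is the $\mathscr L_{\mathcal F}$-algebra with $\mathscr L_{\mathsf K}$-reduct $\mathbf A$ in which each $g_f$ is interpreted as $f^{\mathbf A}$; $\mathsf K[\mathscr L_{\mathcal F}]$ is the class of all such algebras. A pp expansion of $\mathsf K$ is a class of the form $\mathbb S(\mathsf K[\mathscr L_{\mathcal F}])$ ($\mathbb S$ = class of subalgebras) for some such $\mathcal F$ and $\mathscr L_{\mathcal F}$; it is equational when it is induced in this way by some $\mathcal F\subseteq\mathrm{ext}_{eq}(\mathsf K)$. A pp expansion $\mathsf M$ of $\mathsf K$ is a Beth companion of $\mathsf K$ when for every $n$-ary implicit operation $f$ of $\mathsf K$ there is a set $T$ of terms $t(x_1,\dots,x_n)$ of $\mathsf M$ such that for all $\mathbf A\in\mathsf M$ and $\vec a\in\mathrm{dom}(f^{\mathbf A{\upharpoonright}_{\mathscr L_{\mathsf K}}})$ there is $t\in T$ with $f^{\mathbf A{\upharpoonright}_{\mathscr L_{\mathsf K}}}(\vec a)=t^{\mathbf A}(\vec a)$. An equational Beth companion is a Beth companion that is equational as a pp expansion. *)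

theory Defs
  imports "HOL-Algebra.Group"
begin

text \<open>
  HOL has no type of all algebras, so a class of algebras is rendered by a set of algebras whose
  universes are subsets of a type \<open>'a\<close>, and concrete classes (torsion-free Abelian groups, say) are
  constants polymorphic in \<open>'a\<close>. The type \<open>'a\<close> bounds the cardinality of the algebras, and the
  universe of an algebra can exhaust it. Hence wherever the existence of an extension
  \<open>A \<le> B\<close> within a class is at stake, \<open>A\<close> is only required to be isomorphic to a subalgebra of \<open>B\<close>;
  for classes closed under isomorphism this is the same notion. Over a finite type the only
  torsion-free Abelian groups are trivial and all division operations coincide, so \<open>'a\<close> has to be
  infinite for these operations to be indexed faithfully by their divisors.
\<close>


subsection \<open>Algebras\<close>

type_synonym 's lang = "'s \<rightharpoonup> nat"

record ('a, 's) ualg = "'a partial_object" +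
  interp :: "'s \<Rightarrow> 'a list \<Rightarrow> 'a"

definition tuples :: "nat \<Rightarrow> 'a set \<Rightarrow> 'a list set" where
  "tuples n X = {xs. length xs = n \<and> set xs \<subseteq> X}"

text \<open>
  Interpretations are fixed to be \<^const>\<open>undefined\<close> off their domain, so that equality of algebras is
  the equality of their universes and of their basic operations.
\<close>

definition is_alg :: "'s lang \<Rightarrow> ('a, 's) ualg \<Rightarrow> bool" where
  "is_alg L A \<longleftrightarrow> carrier A \<noteq> {} \<and>
     (\<forall>s. case L s of
            Some n \<Rightarrow> interp A s \<in> tuples n (carrier A) \<rightarrow>\<^sub>E carrier A
          | None \<Rightarrow> interp A s = (\<lambda>_. undefined))"

definition reduct :: "'s lang \<Rightarrow> ('a, 's) ualg \<Rightarrow> ('a, 's) ualg" where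
  "reduct L A = A\<lparr>interp := (\<lambda>s. if s \<in> dom L then interp A s else (\<lambda>_. undefined))\<rparr>"

definition alg_hom :: "'s lang \<Rightarrow> ('a, 's) ualg \<Rightarrow> ('b, 's) ualg \<Rightarrow> ('a \<Rightarrow> 'b) \<Rightarrow> bool" where
  "alg_hom L A B h \<longleftrightarrow> h \<in> carrier A \<rightarrow> carrier B \<and>
     (\<forall>s n. L s = Some n \<longrightarrow>
        (\<forall>xs\<in>tuples n (carrier A). h (interp A s xs) = interp B s (map h xs)))"

definition alg_iso :: "'s lang \<Rightarrow> ('a, 's) ualg \<Rightarrow> ('b, 's) ualg \<Rightarrow> ('a \<Rightarrow> 'b) \<Rightarrow> bool" where
  "alg_iso L A B h \<longleftrightarrow> alg_hom L A B h \<and> bij_betw h (carrier A) (carrier B)"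

definition subalgebra :: "'s lang \<Rightarrow> ('a, 's) ualg \<Rightarrow> ('a, 's) ualg \<Rightarrow> bool" where
  "subalgebra L A B \<longleftrightarrow> is_alg L A \<and> is_alg L B \<and> carrier A \<subseteq> carrier B \<and>
     (\<forall>s n. L s = Some n \<longrightarrow> (\<forall>xs\<in>tuples n (carrier A). interp A s xs = interp B s xs))"

definition prod_alg :: "'s lang \<Rightarrow> 'i set \<Rightarrow> ('i \<Rightarrow> ('a, 's) ualg) \<Rightarrow> ('i \<Rightarrow> 'a, 's) ualg" where
  "prod_alg L I A =
     (let P = (\<Pi>\<^sub>E i\<in>I. carrier (A i)) in
      \<lparr>carrier = P,
       interp = (\<lambda>s. case L s of
           Some n \<Rightarrow> (\<lambda>xs\<in>tuples n P. \<lambda>i\<in>I. interp (A i) s (map (\<lambda>x. x i) xs))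
         | None \<Rightarrow> (\<lambda>_. undefined))\<rparr>)"

text \<open>The class operator \<open>\<S>\<close>, up to isomorphism as explained at the top.\<close>

definition subalgs :: "'s lang \<Rightarrow> ('a, 's) ualg set \<Rightarrow> ('a, 's) ualg set" where
  "subalgs L K = {A. is_alg L A \<and> (\<exists>B\<in>K. \<exists>C h. subalgebra L C B \<and> alg_iso L A C h)}"

text \<open>
  Homomorphic images and direct products may leave the type \<open>'a\<close>. The arguments \<open>K\<close>, \<open>KH\<close>, \<open>KP\<close> of
  the following predicate are meant to be instances, at three types, of the same polymorphic class.
\<close>

definition variety ::
  "'s lang \<Rightarrow> ('a, 's) ualg set \<Rightarrow> ('b, 's) ualg set \<Rightarrow> ('i \<Rightarrow> 'a, 's) ualg set \<Rightarrow> bool" where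
  "variety L K KH KP \<longleftrightarrow>
     (\<forall>A\<in>K. is_alg L A) \<and> (\<forall>A\<in>KH. is_alg L A) \<and> (\<forall>A\<in>KP. is_alg L A) \<and>
     (\<forall>A\<in>K. \<forall>B h. is_alg L B \<and> alg_hom L A B h \<and> h ` carrier A = carrier B \<longrightarrow> B \<in> KH) \<and>
     (\<forall>A\<in>K. \<forall>B. subalgebra L B A \<longrightarrow> B \<in> K) \<and>
     (\<forall>I A. (\<forall>i\<in>I. A i \<in> K) \<longrightarrow> prod_alg L I A \<in> KP)"


subsection \<open>Terms and formulas\<close>

datatype 's trm = Var nat | App 's "'s trm list"

primrec eval :: "('a, 's) ualg \<Rightarrow> (nat \<Rightarrow> 'a) \<Rightarrow> 's trm \<Rightarrow> 'a" where
  "eval A e (Var i) = e i"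
| "eval A e (App s ts) = interp A s (map (eval A e) ts)"

primrec vars :: "'s trm \<Rightarrow> nat set" where
  "vars (Var i) = {i}"
| "vars (App s ts) = \<Union> (set (map vars ts))"

primrec is_trm :: "'s lang \<Rightarrow> 's trm \<Rightarrow> bool" where
  "is_trm L (Var i) \<longleftrightarrow> True"
| "is_trm L (App s ts) \<longleftrightarrow> L s = Some (length ts) \<and> list_all (is_trm L) ts"

datatype 's fm = Eq "'s trm" "'s trm" | Top | Neg "'s fm" | And "'s fm" "'s fm" | Ex nat "'s fm"

primrec sat :: "('a, 's) ualg \<Rightarrow> (nat \<Rightarrow> 'a) \<Rightarrow> 's fm \<Rightarrow> bool" where
  "sat A e (Eq s t) \<longleftrightarrow> eval A e s = eval A e t"
| "sat A e Top \<longleftrightarrow> True"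
| "sat A e (Neg p) \<longleftrightarrow> \<not> sat A e p"
| "sat A e (And p q) \<longleftrightarrow> sat A e p \<and> sat A e q"
| "sat A e (Ex v p) \<longleftrightarrow> (\<exists>x\<in>carrier A. sat A (e(v := x)) p)"

primrec fvars :: "'s fm \<Rightarrow> nat set" where
  "fvars (Eq s t) = vars s \<union> vars t"
| "fvars Top = {}"
| "fvars (Neg p) = fvars p"
| "fvars (And p q) = fvars p \<union> fvars q"
| "fvars (Ex v p) = fvars p - {v}"

primrec is_fm :: "'s lang \<Rightarrow> 's fm \<Rightarrow> bool" where
  "is_fm L (Eq s t) \<longleftrightarrow> is_trm L s \<and> is_trm L t"
| "is_fm L Top \<longleftrightarrow> True"
| "is_fm L (Neg p) \<longleftrightarrow> is_fm L p"
| "is_fm L (And p q) \<longleftrightarrow> is_fm L p \<and> is_fm L q"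
| "is_fm L (Ex v p) \<longleftrightarrow> is_fm L p"

definition conj_eqs :: "('s trm \<times> 's trm) list \<Rightarrow> 's fm" where
  "conj_eqs es = foldr And (map (\<lambda>(s, t). Eq s t) es) Top"

definition eq_fms :: "'s fm set" where
  "eq_fms = range conj_eqs"

definition pp_fms :: "'s fm set" where
  "pp_fms = {foldr Ex vs p | vs p. p \<in> eq_fms}"


subsection \<open>Implicit operations\<close>

text \<open>
  A partial function on a class is paired with its arity, which its graph need not determine.
  It is empty on algebras outside the class.
\<close>

type_synonym ('a, 's) pfun = "nat \<times> (('a, 's) ualg \<Rightarrow> 'a list \<rightharpoonup> 'a)"

definition pfun_on :: "('a, 's) ualg set \<Rightarrow> ('a, 's) pfun \<Rightarrow> bool" where
  "pfun_on K = (\<lambda>(n, f).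
     (\<forall>A\<in>K. dom (f A) \<subseteq> tuples n (carrier A) \<and> ran (f A) \<subseteq> carrier A) \<and>
     (\<forall>A. A \<notin> K \<longrightarrow> f A = Map.empty))"

text \<open>In \<open>\<phi>(x\<^sub>1, \<dots>, x\<^sub>n, y)\<close>, the variables \<open>x\<^sub>1, \<dots>, x\<^sub>n\<close> are numbered \<open>0, \<dots>, n - 1\<close>, and \<open>y\<close> is \<open>n\<close>.\<close>

definition functional :: "'s lang \<Rightarrow> ('a, 's) ualg set \<Rightarrow> nat \<Rightarrow> 's fm \<Rightarrow> bool" where
  "functional L K n p \<longleftrightarrow> 1 \<le> n \<and> is_fm L p \<and> fvars p \<subseteq> {..n} \<and>
     (\<forall>A\<in>K. \<forall>xs\<in>tuples n (carrier A). \<exists>\<^sub>\<le>\<^sub>1 b. b \<in> carrier A \<and> sat A ((!) (xs @ [b])) p)"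

definition defined_by :: "'s lang \<Rightarrow> ('a, 's) ualg set \<Rightarrow> ('a, 's) pfun \<Rightarrow> 's fm \<Rightarrow> bool" where
  "defined_by L K = (\<lambda>(n, f) p.
     pfun_on K (n, f) \<and> functional L K n p \<and>
     (\<forall>A\<in>K. \<forall>xs\<in>tuples n (carrier A). \<forall>b\<in>carrier A.
        f A xs = Some b \<longleftrightarrow> sat A ((!) (xs @ [b])) p))"

definition hom_preserved :: "'s lang \<Rightarrow> ('a, 's) ualg set \<Rightarrow> ('a, 's) pfun \<Rightarrow> bool" where
  "hom_preserved L K = (\<lambda>(n, f).
     \<forall>A\<in>K. \<forall>B\<in>K. \<forall>h. alg_hom L A B h \<longrightarrow>
       (\<forall>xs b. f A xs = Some b \<longrightarrow> f B (map h xs) = Some (h b)))"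

definition implicit_operation :: "'s lang \<Rightarrow> ('a, 's) ualg set \<Rightarrow> ('a, 's) pfun \<Rightarrow> bool" where
  "implicit_operation L K f \<longleftrightarrow> (\<exists>p. defined_by L K f p) \<and> hom_preserved L K f"

definition extendable :: "'s lang \<Rightarrow> ('a, 's) ualg set \<Rightarrow> ('a, 's) pfun \<Rightarrow> bool" where
  "extendable L K = (\<lambda>(n, f).
     \<forall>A\<in>K. \<forall>xs\<in>tuples n (carrier A).
       \<exists>B\<in>K. \<exists>C h. subalgebra L C B \<and> alg_iso L A C h \<and> map h xs \<in> dom (f B))"

definition ext_pp :: "'s lang \<Rightarrow> ('a, 's) ualg set \<Rightarrow> ('a, 's) pfun set" where
  "ext_pp L K = {f. implicit_operation L K f \<and> extendable L K f \<and> (\<exists>p\<in>pp_fms. defined_by L K f p)}"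

definition ext_eq :: "'s lang \<Rightarrow> ('a, 's) ualg set \<Rightarrow> ('a, 's) pfun set" where
  "ext_eq L K = {f. implicit_operation L K f \<and> extendable L K f \<and> (\<exists>p\<in>eq_fms. defined_by L K f p)}"


subsection \<open>Expansions and Beth companions\<close>

text \<open>
  An expansion by a set \<open>F\<close> of implicit operations is presented by a map \<open>d\<close>, the inverse of
  \<open>f \<mapsto> g\<^sub>f\<close>: its domain consists of the new symbols, and it sends \<open>g\<^sub>f\<close> to \<open>f\<close>.
\<close>

definition expansion_symbols :: "'s lang \<Rightarrow> ('a, 's) pfun set \<Rightarrow> ('s \<rightharpoonup> ('a, 's) pfun) \<Rightarrow> bool" where
  "expansion_symbols L F d \<longleftrightarrow> dom d \<inter> dom L = {} \<and> inj_on d (dom d) \<and> ran d = F"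

definition expansion_lang :: "'s lang \<Rightarrow> ('s \<rightharpoonup> ('a, 's) pfun) \<Rightarrow> 's lang" where
  "expansion_lang L d = L ++ (\<lambda>s. map_option fst (d s))"

definition expand_alg :: "('s \<rightharpoonup> ('a, 's) pfun) \<Rightarrow> ('a, 's) ualg \<Rightarrow> ('a, 's) ualg" where
  "expand_alg d A = A\<lparr>interp := (\<lambda>s. case d s of
       Some (n, f) \<Rightarrow> (\<lambda>xs\<in>tuples n (carrier A). the (f A xs))
     | None \<Rightarrow> interp A s)\<rparr>"

definition expand_class ::
  "('s \<rightharpoonup> ('a, 's) pfun) \<Rightarrow> ('a, 's) ualg set \<Rightarrow> ('a, 's) ualg set" where
  "expand_class d K =
     {expand_alg d A | A. A \<in> K \<and> (\<forall>(n, f)\<in>ran d. dom (f A) = tuples n (carrier A))}"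

definition induced_by ::
  "'s lang \<Rightarrow> ('a, 's) ualg set \<Rightarrow> ('a, 's) pfun set \<Rightarrow> 's lang \<Rightarrow> ('a, 's) ualg set \<Rightarrow> bool" where
  "induced_by L K F L' M \<longleftrightarrow>
     (\<exists>d. expansion_symbols L F d \<and> L' = expansion_lang L d \<and> M = subalgs L' (expand_class d K))"

definition pp_expansion ::
  "'s lang \<Rightarrow> ('a, 's) ualg set \<Rightarrow> 's lang \<Rightarrow> ('a, 's) ualg set \<Rightarrow> bool" where
  "pp_expansion L K L' M \<longleftrightarrow> (\<exists>F \<subseteq> ext_pp L K. induced_by L K F L' M)"

definition equational_expansion ::
  "'s lang \<Rightarrow> ('a, 's) ualg set \<Rightarrow> 's lang \<Rightarrow> ('a, 's) ualg set \<Rightarrow> bool" where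
  "equational_expansion L K L' M \<longleftrightarrow> (\<exists>F \<subseteq> ext_eq L K. induced_by L K F L' M)"

definition Beth_companion ::
  "'s lang \<Rightarrow> ('a, 's) ualg set \<Rightarrow> 's lang \<Rightarrow> ('a, 's) ualg set \<Rightarrow> bool" where
  "Beth_companion L K L' M \<longleftrightarrow> pp_expansion L K L' M \<and>
     (\<forall>n f. implicit_operation L K (n, f) \<longrightarrow>
        (\<exists>T \<subseteq> {t. is_trm L' t \<and> vars t \<subseteq> {..<n}}.
           \<forall>A\<in>M. \<forall>xs\<in>dom (f (reduct L A)).
             \<exists>t\<in>T. f (reduct L A) xs = Some (eval A ((!) xs) t)))"

definition equational_Beth_companion ::
  "'s lang \<Rightarrow> ('a, 's) ualg set \<Rightarrow> 's lang \<Rightarrow> ('a, 's) ualg set \<Rightarrow> bool" where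
  "equational_Beth_companion L K L' M \<longleftrightarrow>
     Beth_companion L K L' M \<and> equational_expansion L K L' M"


subsection \<open>Torsion-free Abelian groups and division\<close>

datatype sym = SPlus | SMinus | SZero | SDiv nat

definition AG_lang :: "sym lang" where
  "AG_lang = [SPlus \<mapsto> 2, SMinus \<mapsto> 1, SZero \<mapsto> 0]"

text \<open>The additive group, in the multiplicative notation of the library: \<open>n b\<close> is \<open>b [^] n\<close>.\<close>

definition grp :: "('a, sym) ualg \<Rightarrow> 'a monoid" where
  "grp A = \<lparr>carrier = carrier A, mult = (\<lambda>x y. interp A SPlus [x, y]), one = interp A SZero []\<rparr>"

definition TFAG :: "('a, sym) ualg set" where
  "TFAG = {A. is_alg AG_lang A \<and> comm_group (grp A) \<and>
     (\<forall>x\<in>carrier A. interp A SMinus [x] = inv\<^bsub>grp A\<^esub> x) \<and>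
     (\<forall>x\<in>carrier A. (\<exists>n::nat. 0 < n \<and> x [^]\<^bsub>grp A\<^esub> n = \<one>\<^bsub>grp A\<^esub>) \<longrightarrow> x = \<one>\<^bsub>grp A\<^esub>)}"

definition divide_by :: "nat \<Rightarrow> ('a, sym) ualg \<Rightarrow> 'a list \<rightharpoonup> 'a" where
  "divide_by n A xs =
     (if A \<in> TFAG \<and> (\<exists>b\<in>carrier A. xs = [b [^]\<^bsub>grp A\<^esub> n])
      then Some (THE b. b \<in> carrier A \<and> xs = [b [^]\<^bsub>grp A\<^esub> n])
      else None)"

definition div_symbols :: "sym \<rightharpoonup> ('a, sym) pfun" where
  "div_symbols s = (case s of SDiv n \<Rightarrow> if 0 < n then Some (1, divide_by n) else None | _ \<Rightarrow> None)"

definition DAG_lang :: "sym lang" where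
  "DAG_lang s = (case s of SDiv n \<Rightarrow> if 0 < n then Some 1 else None | _ \<Rightarrow> AG_lang s)"

definition DAG :: "('a, sym) ualg set" where
  "DAG = subalgs DAG_lang (expand_class div_symbols TFAG)"

end

theory Submission
  imports Defs "HOL-Library.Nat_Bijection"
begin

text \<open>
  A torsion-free Abelian group in which every element is divisible by every \<open>n > 0\<close> is the same thing
  as an Abelian group with unary operations \<open>d\<^sub>n\<close> satisfying \<open>n d\<^sub>n(x) = x\<close> and \<open>d\<^sub>n(n x) = x\<close>; these
  identities already force torsion-freeness. So \<open>DAG\<close> is an equational class (\<open>DAG_eq_models\<close>), and
  equational classes are varieties (\<open>variety_models\<close>, the easy half of Birkhoff's theorem).

  The operations \<open>f\<^sub>n\<close> are functional because multiplication by \<open>n\<close> is injective on a torsion-free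
  group, and for the same reason they are extendable: \<open>x \<mapsto> n x\<close> embeds every such group into itself
  with image consisting of multiples of \<open>n\<close> (\<open>divide_by_ext_eq\<close>). They are pairwise distinct, since
  they differ on a copy of the integers; this is where infinity of the type enters.

  For the Beth property, let an implicit operation \<open>f\<close> have the value \<open>b\<close> at \<open>a\<^sub>1, \<dots>, a\<^sub>n\<close> in a member \<open>A\<close>
  of \<open>DAG\<close>, and let \<open>V\<close> be the subalgebra generated by \<open>a\<^sub>1, \<dots>, a\<^sub>n\<close>. In other words, \<open>A\<close> is a rational
  vector space and \<open>V\<close> the linear span. The quotient \<open>A/V\<close> is again torsion-free, and the projection
  \<open>A \<rightarrow> A/V\<close> and the zero map agree on \<open>a\<^sub>1, \<dots>, a\<^sub>n\<close>. Both preserve \<open>f\<close>, so they agree on \<open>b\<close>, that is,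
  \<open>b \<in> V\<close>, and \<open>b\<close> is the value of a term (\<open>implicit_operation_value_is_term_value\<close>). Hence the set
  of all terms in \<open>n\<close> variables witnesses the Beth property of every \<open>n\<close>-ary implicit operation.
\<close>

section \<open>Homomorphisms, subalgebras and quotients\<close>

lemma tuples_simps [simp]:
  "xs \<in> tuples 0 X \<longleftrightarrow> xs = []"
  "xs \<in> tuples 1 X \<longleftrightarrow> (\<exists>x\<in>X. xs = [x])"
  "xs \<in> tuples (Suc 0) X \<longleftrightarrow> (\<exists>x\<in>X. xs = [x])"
  "xs \<in> tuples 2 X \<longleftrightarrow> (\<exists>x\<in>X. \<exists>y\<in>X. xs = [x, y])"
  by (auto simp: tuples_def length_Suc_conv numeral_2_eq_2)

lemma map_in_tuples: "h \<in> X \<rightarrow> Y \<Longrightarrow> xs \<in> tuples n X \<Longrightarrow> map h xs \<in> tuples n Y"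
  by (auto simp: tuples_def)

lemma tuples_image: "tuples n (h ` X) = map h ` tuples n X"
proof -
  have "xs \<in> map h ` tuples n X" if "xs \<in> tuples n (h ` X)" for xs
  proof -
    from that have "xs \<in> lists (h ` X)" by (auto simp: tuples_def)
    then obtain ys where "ys \<in> lists X" "xs = map h ys"
      by (auto simp: lists_image)
    with that show ?thesis by (auto simp: tuples_def)
  qed
  moreover have "map h xs \<in> tuples n (h ` X)" if "xs \<in> tuples n X" for xs
    by (rule map_in_tuples[OF _ that]) auto
  ultimately show ?thesis by blast
qed

lemma is_algD:
  assumes "is_alg L A" "L s = Some n" "xs \<in> tuples n (carrier A)"
  shows "interp A s xs \<in> carrier A"
proof -
  from assms(1) have "case L s of Some n \<Rightarrow> interp A s \<in> tuples n (carrier A) \<rightarrow>\<^sub>E carrier A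
    | None \<Rightarrow> interp A s = (\<lambda>_. undefined)"
    unfolding is_alg_def by blast
  with assms(2,3) show ?thesis by auto
qed

lemma is_alg_undefined:
  assumes "is_alg L A" "L s = None \<or> L s = Some n \<and> xs \<notin> tuples n (carrier A)"
  shows "interp A s xs = undefined"
proof -
  from assms(1) have "case L s of Some n \<Rightarrow> interp A s \<in> tuples n (carrier A) \<rightarrow>\<^sub>E carrier A
    | None \<Rightarrow> interp A s = (\<lambda>_. undefined)"
    unfolding is_alg_def by blast
  with assms(2) show ?thesis by (auto simp: PiE_def extensional_def)
qed

text \<open>
  Packs total operations into an algebra of the given language by making them \<^const>\<open>undefined\<close>
  wherever \<^const>\<open>is_alg\<close> prescribes it.
\<close>

definition make_alg :: "'s lang \<Rightarrow> 'a set \<Rightarrow> ('s \<Rightarrow> 'a list \<Rightarrow> 'a) \<Rightarrow> ('a, 's) ualg" where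
  "make_alg L X F = \<lparr>carrier = X, interp = (\<lambda>s. case L s of
     Some n \<Rightarrow> \<lambda>xs\<in>tuples n X. F s xs | None \<Rightarrow> (\<lambda>_. undefined))\<rparr>"

lemma carrier_make_alg [simp]: "carrier (make_alg L X F) = X"
  by (simp add: make_alg_def)

lemma interp_make_alg [simp]:
  "L s = Some n \<Longrightarrow> xs \<in> tuples n X \<Longrightarrow> interp (make_alg L X F) s xs = F s xs"
  by (simp add: make_alg_def)

lemma is_alg_make_alg:
  assumes "X \<noteq> {}" "\<And>s n xs. L s = Some n \<Longrightarrow> xs \<in> tuples n X \<Longrightarrow> F s xs \<in> X"
  shows "is_alg L (make_alg L X F)"
  using assms by (auto simp: is_alg_def make_alg_def split: option.split)

lemma alg_homD:
  "alg_hom L A B h \<Longrightarrow> L s = Some n \<Longrightarrow> xs \<in> tuples n (carrier A) \<Longrightarrow>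
     h (interp A s xs) = interp B s (map h xs)"
  by (auto simp: alg_hom_def)

lemma alg_hom_closed: "alg_hom L A B h \<Longrightarrow> x \<in> carrier A \<Longrightarrow> h x \<in> carrier B"
  by (auto simp: alg_hom_def)

text \<open>
  Extendability asks for an isomorphism onto a subalgebra; this lets it be proved by exhibiting an
  embedding.
\<close>

lemma embedding_onto_subalgebra:
  assumes "is_alg L A" "is_alg L B" "alg_hom L A B h" "inj_on h (carrier A)"
  shows "\<exists>C. subalgebra L C B \<and> alg_iso L A C h"
proof -
  define C where "C = make_alg L (h ` carrier A) (interp B)"
  have "is_alg L C"
    unfolding C_def
  proof (rule is_alg_make_alg)
    show "h ` carrier A \<noteq> {}" using assms(1) by (auto simp: is_alg_def)
    fix s n xs assume s: "L s = Some n" and "xs \<in> tuples n (h ` carrier A)"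
    then obtain ys where "ys \<in> tuples n (carrier A)" "xs = map h ys"
      by (auto simp: tuples_image)
    with alg_homD[OF assms(3) s] is_algD[OF assms(1) s]
    show "interp B s xs \<in> h ` carrier A" by (metis image_eqI)
  qed
  moreover have "h ` carrier A \<subseteq> carrier B"
    using assms(3) by (auto simp: alg_hom_def)
  ultimately have "subalgebra L C B"
    using assms(2) by (auto simp: subalgebra_def C_def)
  moreover have "alg_hom L A C h"
    using assms(3) by (auto simp: alg_hom_def C_def tuples_image)
  ultimately show ?thesis
    using assms(4) by (auto simp: alg_iso_def bij_betw_def C_def)
qed

text \<open>
  The quotient by a congruence is realized on representatives, so that it stays in the type of the
  algebra: \<open>r\<close> picks a representative of each class, and the assumption on \<open>r\<close> says that its kernel
  is a congruence.
\<close>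

lemma quotient_by_representatives:
  assumes A: "is_alg L A" and r: "r \<in> carrier A \<rightarrow> carrier A"
    and cong: "\<And>s n xs. L s = Some n \<Longrightarrow> xs \<in> tuples n (carrier A) \<Longrightarrow>
      r (interp A s (map r xs)) = r (interp A s xs)"
  shows "\<exists>B. is_alg L B \<and> carrier B = r ` carrier A \<and> alg_hom L A B r"
proof (intro exI conjI)
  let ?B = "make_alg L (r ` carrier A) (\<lambda>s xs. r (interp A s xs))"
  show "is_alg L ?B"
  proof (rule is_alg_make_alg)
    show "r ` carrier A \<noteq> {}" using A by (auto simp: is_alg_def)
    fix s n xs assume s: "L s = Some n" and "xs \<in> tuples n (r ` carrier A)"
    then have "xs \<in> tuples n (carrier A)"
      using r by (auto simp: tuples_def)
    with s show "r (interp A s xs) \<in> r ` carrier A"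
      using is_algD[OF A] by blast
  qed
  show "alg_hom L A ?B r"
    using cong by (auto simp: alg_hom_def tuples_image)
qed simp

lemma is_alg_reduct:
  assumes "is_alg L A" "L' \<subseteq>\<^sub>m L"
  shows "is_alg L' (reduct L' A)"
  unfolding is_alg_def
proof (intro conjI allI)
  show "carrier (reduct L' A) \<noteq> {}"
    using assms(1) by (simp add: is_alg_def reduct_def)
  fix s
  have "case L s of Some n \<Rightarrow> interp A s \<in> tuples n (carrier A) \<rightarrow>\<^sub>E carrier A
    | None \<Rightarrow> interp A s = (\<lambda>_. undefined)"
    using assms(1) unfolding is_alg_def by blast
  then show "case L' s of
      Some n \<Rightarrow> interp (reduct L' A) s \<in> tuples n (carrier (reduct L' A)) \<rightarrow>\<^sub>E carrier (reduct L' A)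
    | None \<Rightarrow> interp (reduct L' A) s = (\<lambda>_. undefined)"
    using assms(2) by (cases "L' s") (auto simp: reduct_def dom_def map_le_def)
qed

lemma alg_hom_reduct:
  assumes "alg_hom L A B h" "L' \<subseteq>\<^sub>m L"
  shows "alg_hom L' (reduct L' A) (reduct L' B) h"
  using assms by (force simp: alg_hom_def reduct_def dom_def map_le_def)


section \<open>Equational classes are varieties\<close>

lemma eval_closed:
  assumes "is_alg L A" "is_trm L t" "\<And>i. i \<in> vars t \<Longrightarrow> e i \<in> carrier A"
  shows "eval A e t \<in> carrier A"
  using assms(2,3)
proof (induction t)
  case (App s ts)
  then have "map (eval A e) ts \<in> tuples (length ts) (carrier A)"
    by (auto simp: tuples_def list_all_iff)
  with App.prems show ?case using is_algD[OF assms(1)] by auto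
qed simp

lemma eval_hom:
  assumes "is_alg L A" "alg_hom L A B h" "is_trm L t" "\<And>i. i \<in> vars t \<Longrightarrow> e i \<in> carrier A"
  shows "h (eval A e t) = eval B (\<lambda>i. h (e i)) t"
  using assms(3,4)
proof (induction t)
  case (App s ts)
  then have "map (eval A e) ts \<in> tuples (length ts) (carrier A)"
    by (fastforce simp: tuples_def list_all_iff intro!: eval_closed[OF assms(1)])
  moreover have "map h (map (eval A e) ts) = map (eval B (\<lambda>i. h (e i))) ts"
    using App by (auto simp: list_all_iff)
  ultimately show ?case
    using App.prems alg_homD[OF assms(2), of s "length ts" "map (eval A e) ts"]
    by (simp del: map_map)
qed simp

definition models :: "'s lang \<Rightarrow> ('s trm \<times> 's trm) set \<Rightarrow> ('a, 's) ualg set" where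
  "models L E = {A. is_alg L A \<and>
     (\<forall>(s, t)\<in>E. \<forall>e. (\<forall>i. e i \<in> carrier A) \<longrightarrow> eval A e s = eval A e t)}"

lemma modelsD:
  "A \<in> models L E \<Longrightarrow> (s, t) \<in> E \<Longrightarrow> (\<And>i. e i \<in> carrier A) \<Longrightarrow> eval A e s = eval A e t"
  by (auto simp: models_def)

text \<open>
  Since an injective homomorphism reflects identities, this covers both subalgebras and isomorphic
  copies.
\<close>

lemma models_embedding:
  assumes E: "E \<subseteq> {(s, t). is_trm L s \<and> is_trm L t}"
    and B: "B \<in> models L E" and A: "is_alg L A"
    and h: "alg_hom L A B h" "inj_on h (carrier A)"
  shows "A \<in> models L E"
proof -
  have "eval A e s = eval A e t" if st: "(s, t) \<in> E" and e: "\<forall>i. e i \<in> carrier A" for s t e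
  proof (rule inj_onD[OF h(2)])
    show "h (eval A e s) = h (eval A e t)"
      using subsetD[OF E st] e modelsD[OF B st, of "\<lambda>i. h (e i)"] alg_hom_closed[OF h(1)]
      by (subst (1 2) eval_hom[OF A h(1)]) auto
  qed (use subsetD[OF E st] e in \<open>auto intro!: eval_closed[OF A]\<close>)
  with A show ?thesis by (auto simp: models_def)
qed

lemma models_image:
  assumes E: "E \<subseteq> {(s, t). is_trm L s \<and> is_trm L t}"
    and A: "A \<in> models L E" and B: "is_alg L B"
    and h: "alg_hom L A B h" "h ` carrier A = carrier B"
  shows "B \<in> models L E"
proof -
  from A have A': "is_alg L A" by (simp add: models_def)
  have "eval B e s = eval B e t" if st: "(s, t) \<in> E" and e: "\<forall>i. e i \<in> carrier B" for s t e
  proof -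
    have "\<forall>i. \<exists>x. x \<in> carrier A \<and> h x = e i"
      using e h(2) by (metis imageE)
    then obtain e' where e': "\<And>i. e' i \<in> carrier A" "\<And>i. h (e' i) = e i" by metis
    have "eval A e' s = eval A e' t" by (rule modelsD[OF A st e'(1)])
    with eval_hom[OF A' h(1), of s e'] eval_hom[OF A' h(1), of t e'] subsetD[OF E st] e'
    show ?thesis by simp
  qed
  with B show ?thesis by (auto simp: models_def)
qed

lemma is_alg_prod_alg:
  assumes "\<And>i. i \<in> I \<Longrightarrow> is_alg L (A i)"
  shows "is_alg L (prod_alg L I A)"
proof -
  let ?P = "\<Pi>\<^sub>E i\<in>I. carrier (A i)"
  have eq: "prod_alg L I A = make_alg L ?P (\<lambda>s xs. \<lambda>i\<in>I. interp (A i) s (map (\<lambda>x. x i) xs))"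
    by (simp add: prod_alg_def make_alg_def Let_def)
  show ?thesis
    unfolding eq
  proof (rule is_alg_make_alg)
    show "?P \<noteq> {}"
      using assms by (auto simp: PiE_eq_empty_iff is_alg_def)
    fix s n xs assume s: "L s = Some n" and xs: "xs \<in> tuples n ?P"
    have "interp (A i) s (map (\<lambda>x. x i) xs) \<in> carrier (A i)" if "i \<in> I" for i
      by (rule is_algD[OF assms[OF that] s], rule map_in_tuples[OF _ xs]) (use that in auto)
    then show "(\<lambda>i\<in>I. interp (A i) s (map (\<lambda>x. x i) xs)) \<in> ?P" by auto
  qed
qed

lemma alg_hom_projection:
  assumes "i \<in> I"
  shows "alg_hom L (prod_alg L I A) (A i) (\<lambda>x. x i)"
  using assms by (auto simp: alg_hom_def prod_alg_def Let_def)

lemma models_product: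
  assumes E: "E \<subseteq> {(s, t). is_trm L s \<and> is_trm L t}"
    and A: "\<And>i. i \<in> I \<Longrightarrow> A i \<in> models L E"
  shows "prod_alg L I A \<in> models L E"
proof -
  let ?P = "prod_alg L I A"
  have P: "is_alg L ?P"
    by (rule is_alg_prod_alg) (use A in \<open>simp add: models_def\<close>)
  have car: "carrier ?P = (\<Pi>\<^sub>E i\<in>I. carrier (A i))"
    by (simp add: prod_alg_def Let_def)
  have "eval ?P e s = eval ?P e t" if st: "(s, t) \<in> E" and e: "\<forall>i. e i \<in> carrier ?P" for s t e
  proof (rule PiE_ext)
    show "eval ?P e s \<in> (\<Pi>\<^sub>E i\<in>I. carrier (A i))" "eval ?P e t \<in> (\<Pi>\<^sub>E i\<in>I. carrier (A i))"
      unfolding car[symmetric] using subsetD[OF E st] e by (auto intro!: eval_closed[OF P])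
    fix i assume i: "i \<in> I"
    have "eval (A i) (\<lambda>v. e v i) s = eval (A i) (\<lambda>v. e v i) t"
      by (rule modelsD[OF A[OF i] st], rule alg_hom_closed[OF alg_hom_projection[OF i]])
        (use e in auto)
    with eval_hom[OF P alg_hom_projection[OF i], of s e]
      eval_hom[OF P alg_hom_projection[OF i], of t e] subsetD[OF E st] e
    show "eval ?P e s i = eval ?P e t i" by auto
  qed
  with P show ?thesis by (auto simp: models_def)
qed

text \<open>
  The easy half of Birkhoff's theorem. Homomorphisms commute with the evaluation of terms, so
  identities can be pulled back along embeddings, checked along the projections of a product, and
  pushed forward along surjections after lifting the assignment.
\<close>

theorem variety_models:
  assumes E: "E \<subseteq> {(s, t). is_trm L s \<and> is_trm L t}"
  shows "variety L (models L E) (models L E) (models L E)"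
  unfolding variety_def
proof (intro conjI ballI allI impI)
  fix A B assume A: "A \<in> models L E" and B: "subalgebra L B A"
  then have "alg_hom L B A id"
    by (auto simp: subalgebra_def alg_hom_def)
  with A B show "B \<in> models L E"
    by (intro models_embedding[OF E A]) (auto simp: subalgebra_def)
next
  fix A B h
  assume "A \<in> models L E" "is_alg L B \<and> alg_hom L A B h \<and> h ` carrier A = carrier B"
  then show "B \<in> models L E" by (blast intro: models_image[OF E])
next
  fix I A assume "\<forall>i\<in>I. A i \<in> models L E"
  then show "prod_alg L I A \<in> models L E" by (blast intro: models_product[OF E])
qed (simp_all add: models_def)


section \<open>Torsion-free Abelian groups\<close>

lemma AG_lang_eq [simp]:
  "AG_lang SPlus = Some 2" "AG_lang SMinus = Some 1" "AG_lang SZero = Some 0"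
  "AG_lang (SDiv n) = None"
  by (auto simp: AG_lang_def)

lemma DAG_lang_eq [simp]:
  "DAG_lang SPlus = Some 2" "DAG_lang SMinus = Some 1" "DAG_lang SZero = Some 0"
  "DAG_lang (SDiv n) = (if 0 < n then Some 1 else None)"
  by (auto simp: DAG_lang_def)

lemma AG_lang_le_DAG_lang: "AG_lang \<subseteq>\<^sub>m DAG_lang"
proof -
  have "AG_lang s = DAG_lang s" if "s \<in> dom AG_lang" for s
    using that by (cases s) auto
  then show ?thesis by (simp add: map_le_def)
qed

lemma grp_simps [simp]:
  "carrier (grp A) = carrier A"
  "x \<otimes>\<^bsub>grp A\<^esub> y = interp A SPlus [x, y]"
  "\<one>\<^bsub>grp A\<^esub> = interp A SZero []"
  by (auto simp: grp_def)

primrec multiple :: "nat \<Rightarrow> sym trm \<Rightarrow> sym trm" where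
  "multiple 0 t = App SZero []"
| "multiple (Suc n) t = App SPlus [multiple n t, t]"

lemma eval_multiple: "eval A e (multiple n t) = eval A e t [^]\<^bsub>grp A\<^esub> n"
  by (induction n) auto

lemma is_trm_multiple:
  assumes "L SPlus = Some 2" "L SZero = Some 0" "is_trm L t"
  shows "is_trm L (multiple n t)"
  using assms by (induction n) auto

lemma vars_multiple: "vars (multiple n t) \<subseteq> vars t"
  by (induction n) auto

lemma TFAG_group:
  assumes "A \<in> TFAG"
  shows "is_alg AG_lang A" "comm_group (grp A)"
    "x \<in> carrier A \<Longrightarrow> interp A SMinus [x] = inv\<^bsub>grp A\<^esub> x"
  using assms by (auto simp: TFAG_def)

text \<open>
  Torsion-freeness is stated for one element; applied to \<open>x - y\<close> it makes multiplication by a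
  positive integer injective, so that quotients are unique.
\<close>

lemma TFAG_pow_inj:
  assumes A: "A \<in> TFAG" and n: "0 < (n::nat)" and xy: "x \<in> carrier A" "y \<in> carrier A"
    and eq: "x [^]\<^bsub>grp A\<^esub> n = y [^]\<^bsub>grp A\<^esub> n"
  shows "x = y"
proof -
  interpret comm_group "grp A" by (rule TFAG_group[OF A])
  have car: "x \<in> carrier (grp A)" "y \<in> carrier (grp A)" using xy by auto
  have "(x \<otimes>\<^bsub>grp A\<^esub> inv\<^bsub>grp A\<^esub> y) [^]\<^bsub>grp A\<^esub> n = x [^]\<^bsub>grp A\<^esub> n \<otimes>\<^bsub>grp A\<^esub> inv\<^bsub>grp A\<^esub> (y [^]\<^bsub>grp A\<^esub> n)"
    using car by (simp add: nat_pow_distrib nat_pow_inv del: grp_simps)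
  also have "\<dots> = \<one>\<^bsub>grp A\<^esub>"
    unfolding eq using car by (simp only: r_inv nat_pow_closed)
  finally have "x \<otimes>\<^bsub>grp A\<^esub> inv\<^bsub>grp A\<^esub> y = \<one>\<^bsub>grp A\<^esub>"
    using A n m_closed[OF car(1) inv_closed[OF car(2)]] by (auto simp: TFAG_def)
  with car show ?thesis by (metis inv_closed inv_equality inv_inv)
qed

lemma alg_hom_multiple:
  assumes "A \<in> TFAG" "alg_hom AG_lang A B h" "x \<in> carrier A"
  shows "h (x [^]\<^bsub>grp A\<^esub> (n::nat)) = h x [^]\<^bsub>grp B\<^esub> n"
  using eval_hom[OF TFAG_group(1)[OF assms(1)] assms(2), of "multiple n (Var 0)" "\<lambda>_. x"] assms(3)
  by (simp add: eval_multiple is_trm_multiple)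

lemma multiple_endomorphism:
  assumes A: "A \<in> TFAG"
  shows "alg_hom AG_lang A A (\<lambda>x. x [^]\<^bsub>grp A\<^esub> (n::nat))"
proof -
  interpret comm_group "grp A" by (rule TFAG_group[OF A])
  have "(interp A s xs) [^]\<^bsub>grp A\<^esub> n = interp A s (map (\<lambda>x. x [^]\<^bsub>grp A\<^esub> n) xs)"
    if "AG_lang s = Some k" "xs \<in> tuples k (carrier A)" for s k xs
  proof (cases s)
    case SPlus
    with that obtain x y where "xs = [x, y]" "x \<in> carrier A" "y \<in> carrier A" by auto
    then show ?thesis
      using SPlus nat_pow_distrib[of x y n] by simp
  next
    case SMinus
    with that obtain x where "xs = [x]" "x \<in> carrier A" by auto
    then show ?thesis
      using SMinus nat_pow_inv[of x n] TFAG_group(3)[OF A] nat_pow_closed[of x n] by simp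
  next
    case SZero
    with that show ?thesis using nat_pow_one[of n] by simp
  qed (use that in auto)
  then show ?thesis
    using nat_pow_closed by (auto simp: alg_hom_def)
qed


section \<open>Division as an extendable implicit operation\<close>

lemma divide_by_eq_Some:
  assumes "0 < n"
  shows "divide_by n A xs = Some b \<longleftrightarrow> A \<in> TFAG \<and> b \<in> carrier A \<and> xs = [b [^]\<^bsub>grp A\<^esub> n]"
proof (cases "A \<in> TFAG \<and> (\<exists>b\<in>carrier A. xs = [b [^]\<^bsub>grp A\<^esub> n])")
  case True
  then obtain c where c: "A \<in> TFAG" "c \<in> carrier A" "xs = [c [^]\<^bsub>grp A\<^esub> n]" by auto
  then have "(THE b. b \<in> carrier A \<and> xs = [b [^]\<^bsub>grp A\<^esub> n]) = c"
    using TFAG_pow_inj[OF c(1) assms] by (intro the_equality) auto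
  with True c show ?thesis
    using TFAG_pow_inj[OF c(1) assms] by (auto simp: divide_by_def)
qed (auto simp: divide_by_def)

text \<open>
  The witness of extendability is the algebra itself: \<open>x \<mapsto> n x\<close> embeds it into itself, and under
  this embedding every element becomes divisible by \<open>n\<close>. This keeps the
  extension within the cardinality of the type.
\<close>

lemma extendable_divide_by:
  assumes "0 < n"
  shows "extendable AG_lang TFAG (1, divide_by n)"
proof -
  have "\<exists>C h. subalgebra AG_lang C A \<and> alg_iso AG_lang A C h \<and> map h xs \<in> dom (divide_by n A)"
    if A: "A \<in> TFAG" and xs: "xs \<in> tuples 1 (carrier A)" for A :: "('a, sym) ualg" and xs
  proof -
    let ?h = "\<lambda>x. x [^]\<^bsub>grp A\<^esub> n"
    have "inj_on ?h (carrier A)"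
      by (rule inj_onI) (rule TFAG_pow_inj[OF A assms])
    then obtain C where "subalgebra AG_lang C A" "alg_iso AG_lang A C ?h"
      using embedding_onto_subalgebra multiple_endomorphism[OF A] TFAG_group(1)[OF A] by blast
    moreover from xs A have "map ?h xs \<in> dom (divide_by n A)"
      by (auto simp: dom_def divide_by_eq_Some[OF assms])
    ultimately show ?thesis by blast
  qed
  then show ?thesis unfolding extendable_def by blast
qed

definition division_fm :: "nat \<Rightarrow> sym fm" where
  "division_fm n = conj_eqs [(Var 0, multiple n (Var 1))]"

lemma sat_division_fm: "sat A ((!) [x, b]) (division_fm n) \<longleftrightarrow> x = b [^]\<^bsub>grp A\<^esub> n"
  by (simp add: division_fm_def conj_eqs_def eval_multiple)

lemma defined_by_division_fm:
  assumes "0 < n"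
  shows "defined_by AG_lang TFAG (1, divide_by n) (division_fm n)"
proof -
  have "pfun_on TFAG (1, divide_by n)"
  proof -
    have "b [^]\<^bsub>grp A\<^esub> n \<in> carrier A" if "A \<in> TFAG" "b \<in> carrier A" for A b
      using alg_hom_closed[OF multiple_endomorphism[OF that(1)] that(2)] .
    moreover have "divide_by n A = Map.empty" if "A \<notin> TFAG" for A
      using that by (auto simp: divide_by_def fun_eq_iff)
    ultimately show ?thesis
      by (auto simp: pfun_on_def dom_def ran_def divide_by_eq_Some[OF assms])
  qed
  moreover have "functional AG_lang TFAG 1 (division_fm n)"
  proof -
    have "is_fm AG_lang (division_fm n)" "fvars (division_fm n) \<subseteq> {..1}"
      using vars_multiple[of n "Var 1"]
      by (auto simp: division_fm_def conj_eqs_def is_trm_multiple)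
    moreover have "\<exists>\<^sub>\<le>\<^sub>1 b. b \<in> carrier A \<and> x = b [^]\<^bsub>grp A\<^esub> n" if "A \<in> TFAG" for A x
      using TFAG_pow_inj[OF that assms] by (auto intro!: Uniq_I)
    ultimately show ?thesis
      by (auto simp: functional_def sat_division_fm)
  qed
  ultimately show ?thesis
    by (auto simp: defined_by_def sat_division_fm divide_by_eq_Some[OF assms])
qed

lemma divide_by_ext_eq:
  assumes "0 < n"
  shows "(1, divide_by n) \<in> ext_eq AG_lang TFAG"
proof -
  have "hom_preserved AG_lang TFAG (1, divide_by n)"
    by (auto simp: hom_preserved_def divide_by_eq_Some[OF assms] alg_hom_multiple alg_hom_closed)
  moreover have "division_fm n \<in> eq_fms"
    by (simp add: division_fm_def eq_fms_def)
  ultimately show ?thesis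
    using defined_by_division_fm[OF assms] extendable_divide_by[OF assms]
    by (auto simp: ext_eq_def implicit_operation_def)
qed

lemma ext_eq_subset_ext_pp:
  fixes L :: "'s lang"
  shows "ext_eq L K \<subseteq> ext_pp L K"
proof -
  have "p \<in> pp_fms" if "p \<in> eq_fms" for p :: "'s fm"
    using that by (auto simp: pp_fms_def intro!: exI[of _ "[]"])
  then show ?thesis unfolding ext_eq_def ext_pp_def by blast
qed

text \<open>
  The divisions are distinguished by a single group, a copy of the integers: there \<open>n\<close> divided by
  \<open>n\<close> is \<open>1\<close>, and no other positive integer divides \<open>n\<close> with quotient \<open>1\<close>.
\<close>

lemma integers_in_infinite_type:
  assumes "infinite (UNIV :: 'a set)"
  obtains Z :: "('a, sym) ualg" and emb :: "int \<Rightarrow> 'a"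
  where "Z \<in> TFAG" "inj emb" "carrier Z = range emb" "\<And>k n. emb k [^]\<^bsub>grp Z\<^esub> n = emb (int n * k)"
proof -
  obtain g :: "nat \<Rightarrow> 'a" where "inj g"
    using assms infinite_countable_subset by blast
  define emb where "emb = g \<circ> int_encode"
  have inj: "inj emb"
    unfolding emb_def by (intro inj_compose \<open>inj g\<close> inj_int_encode)
  define v where "v = inv_into UNIV emb"
  have v [simp]: "v (emb k) = k" for k
    by (simp add: v_def inj)
  define op where "op s xs = (case s of SPlus \<Rightarrow> v (xs ! 0) + v (xs ! 1) | SMinus \<Rightarrow> - v (xs ! 0) | _ \<Rightarrow> 0)"
    for s xs
  define Z where "Z = make_alg AG_lang (range emb) (\<lambda>s xs. emb (op s xs))"
  have car [simp]: "carrier Z = range emb" by (simp add: Z_def)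
  have [simp]: "interp Z SPlus [emb j, emb k] = emb (j + k)" "interp Z SMinus [emb j] = emb (- j)"
    "interp Z SZero [] = emb 0" for j k
    by (simp_all add: Z_def) (simp_all add: op_def)
  have pow [simp]: "emb k [^]\<^bsub>grp Z\<^esub> n = emb (int n * k)" for k n
    by (induction n) (auto simp: algebra_simps)
  have cg: "comm_group (grp Z)"
  proof (rule comm_groupI)
    fix x assume "x \<in> carrier (grp Z)"
    then obtain k where "x = emb k" by auto
    then show "\<exists>y\<in>carrier (grp Z). y \<otimes>\<^bsub>grp Z\<^esub> x = \<one>\<^bsub>grp Z\<^esub>"
      by (auto intro!: exI[of _ "- k"])
  qed (auto simp: algebra_simps)
  interpret comm_group "grp Z" by (rule cg)
  have "interp Z SMinus [x] = inv\<^bsub>grp Z\<^esub> x" if "x \<in> carrier Z" for x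
    using that by (intro inv_equality[symmetric]) auto
  moreover have "x = \<one>\<^bsub>grp Z\<^esub>"
    if "x \<in> carrier Z" "0 < n" "x [^]\<^bsub>grp Z\<^esub> (n::nat) = \<one>\<^bsub>grp Z\<^esub>" for x n
    using that by (auto simp: inj_eq[OF inj])
  moreover have "is_alg AG_lang Z"
    unfolding Z_def by (rule is_alg_make_alg) auto
  ultimately have "Z \<in> TFAG"
    using cg unfolding TFAG_def by blast
  then show thesis using inj car pow that by blast
qed

lemma inj_divide_by:
  assumes inf: "infinite (UNIV :: 'a set)" and n: "0 < n" "0 < m"
    and eq: "(divide_by n :: ('a, sym) ualg \<Rightarrow> _) = divide_by m"
  shows "n = m"
proof -
  obtain Z :: "('a, sym) ualg" and emb where Z: "Z \<in> TFAG" "inj emb" "carrier Z = range emb"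
    "\<And>k n. emb k [^]\<^bsub>grp Z\<^esub> n = emb (int n * k)"
    using integers_in_infinite_type[OF inf] by blast
  have "divide_by n Z [emb (int n)] = Some (emb 1)"
    using Z by (auto simp: divide_by_eq_Some[OF n(1)])
  with eq have "divide_by m Z [emb (int n)] = Some (emb 1)" by simp
  then show "n = m"
    using Z by (simp add: divide_by_eq_Some[OF n(2)] inj_eq[OF Z(2)])
qed

lemma div_symbols_simps [simp]:
  "div_symbols SPlus = None" "div_symbols SMinus = None" "div_symbols SZero = None"
  "div_symbols (SDiv n) = (if 0 < n then Some (1, divide_by n) else None)"
  by (auto simp: div_symbols_def)

lemma ran_div_symbols: "ran div_symbols = {(1, divide_by n) | n. 0 < n}"
proof -
  have "(\<exists>s. div_symbols s = Some f) \<longleftrightarrow> (\<exists>n>0. f = (1, divide_by n))" for f :: "('a, sym) pfun"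
  proof
    assume "\<exists>s. div_symbols s = Some f"
    then obtain s where "div_symbols s = Some f" ..
    then show "\<exists>n>0. f = (1, divide_by n)" by (cases s) (auto split: if_splits)
  next
    assume "\<exists>n>0. f = (1, divide_by n)"
    then obtain n where "0 < n" "f = (1, divide_by n)" by blast
    then show "\<exists>s. div_symbols s = Some f" by (intro exI[of _ "SDiv n"]) simp
  qed
  then show ?thesis by (auto simp: ran_def)
qed

lemma expansion_lang_div_symbols:
  "expansion_lang AG_lang (div_symbols :: sym \<rightharpoonup> ('a, sym) pfun) = DAG_lang"
proof
  fix s show "expansion_lang AG_lang (div_symbols :: sym \<rightharpoonup> ('a, sym) pfun) s = DAG_lang s"
    by (cases s) (auto simp: expansion_lang_def map_add_def)
qed

lemma expansion_symbols_div_symbols: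
  assumes "infinite (UNIV :: 'a set)"
  shows "expansion_symbols AG_lang (ran div_symbols) (div_symbols :: sym \<rightharpoonup> ('a, sym) pfun)"
proof -
  have "s = s'" if "s \<in> dom div_symbols" "s' \<in> dom div_symbols"
    "(div_symbols s :: ('a, sym) pfun option) = div_symbols s'" for s s'
    using that by (cases s; cases s') (auto split: if_splits dest: inj_divide_by[OF assms])
  moreover have "dom (div_symbols :: sym \<rightharpoonup> ('a, sym) pfun) \<inter> dom AG_lang = {}"
    by (auto simp: AG_lang_def)
  ultimately show ?thesis
    by (auto simp: expansion_symbols_def inj_on_def)
qed


section \<open>Divisible torsion-free Abelian groups form an equational class\<close>

text \<open>
  The last two families say that \<open>d\<^sub>n\<close> inverts multiplication by \<open>n\<close> on both sides. They entail
  torsion-freeness, which is not itself equational: if \<open>n x = 0 = n 0\<close>, apply \<open>d\<^sub>n\<close>.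
\<close>

definition DAG_axioms :: "(sym trm \<times> sym trm) set" where
  "DAG_axioms =
     (let x = Var 0; y = Var 1; z = Var 2; plus = (\<lambda>s t. App SPlus [s, t]) in
      {(plus (plus x y) z, plus x (plus y z)), (plus x y, plus y x),
       (plus (App SZero []) x, x), (plus (App SMinus [x]) x, App SZero [])} \<union>
      (\<Union>n\<in>{0<..}. {(multiple n (App (SDiv n) [x]), x), (App (SDiv n) [multiple n x], x)}))"

lemma is_trm_DAG_axioms: "DAG_axioms \<subseteq> {(s, t). is_trm DAG_lang s \<and> is_trm DAG_lang t}"
  by (auto simp: DAG_axioms_def Let_def is_trm_multiple)

lemma models_DAG_axiomsD:
  assumes A: "A \<in> models DAG_lang DAG_axioms"
  shows "is_alg DAG_lang A" "comm_group (grp A)"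
    "\<And>x. x \<in> carrier A \<Longrightarrow> interp A SMinus [x] = inv\<^bsub>grp A\<^esub> x"
    "\<And>n x. 0 < n \<Longrightarrow> x \<in> carrier A \<Longrightarrow> interp A (SDiv n) [x] [^]\<^bsub>grp A\<^esub> n = x"
    "\<And>n x. 0 < n \<Longrightarrow> x \<in> carrier A \<Longrightarrow> interp A (SDiv n) [x [^]\<^bsub>grp A\<^esub> n] = x"
proof -
  show alg: "is_alg DAG_lang A" using A by (simp add: models_def)
  have cl: "interp A s xs \<in> carrier A" if "DAG_lang s = Some n" "xs \<in> tuples n (carrier A)" for s n xs
    using is_algD[OF alg that] .
  \<comment> \<open>The axioms use three variables; the assignment repeats \<open>x, y, z\<close> to stay in the carrier.\<close>
  have ax: "eval A (\<lambda>i. [x, y, z] ! (i mod 3)) s = eval A (\<lambda>i. [x, y, z] ! (i mod 3)) t"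
    if "(s, t) \<in> DAG_axioms" "x \<in> carrier A" "y \<in> carrier A" "z \<in> carrier A" for s t x y z
  proof (rule modelsD[OF A that(1)])
    fix i :: nat
    have "[x, y, z] ! (i mod 3) \<in> set [x, y, z]" by (rule nth_mem) simp
    with that show "[x, y, z] ! (i mod 3) \<in> carrier A" by auto
  qed
  have neg: "interp A SPlus [interp A SMinus [x], x] = interp A SZero []" if "x \<in> carrier A" for x
    using ax[of "App SPlus [App SMinus [Var 0], Var 0]" "App SZero []" x x x] that
    by (simp add: DAG_axioms_def Let_def)
  show cg: "comm_group (grp A)"
  proof (rule comm_groupI)
    fix x y z assume "x \<in> carrier (grp A)" "y \<in> carrier (grp A)" "z \<in> carrier (grp A)"
    then show "x \<otimes>\<^bsub>grp A\<^esub> y \<otimes>\<^bsub>grp A\<^esub> z = x \<otimes>\<^bsub>grp A\<^esub> (y \<otimes>\<^bsub>grp A\<^esub> z)"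
      using ax[of "App SPlus [App SPlus [Var 0, Var 1], Var 2]"
          "App SPlus [Var 0, App SPlus [Var 1, Var 2]]" x y z]
      by (simp add: DAG_axioms_def Let_def)
  next
    fix x y assume "x \<in> carrier (grp A)" "y \<in> carrier (grp A)"
    then show "x \<otimes>\<^bsub>grp A\<^esub> y = y \<otimes>\<^bsub>grp A\<^esub> x" "x \<otimes>\<^bsub>grp A\<^esub> y \<in> carrier (grp A)"
      using ax[of "App SPlus [Var 0, Var 1]" "App SPlus [Var 1, Var 0]" x y x] cl[of SPlus]
      by (simp_all add: DAG_axioms_def Let_def)
  next
    fix x assume x: "x \<in> carrier (grp A)"
    then show "\<one>\<^bsub>grp A\<^esub> \<otimes>\<^bsub>grp A\<^esub> x = x"
      using ax[of "App SPlus [App SZero [], Var 0]" "Var 0" x x x]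
      by (simp add: DAG_axioms_def Let_def)
    show "\<exists>y\<in>carrier (grp A). y \<otimes>\<^bsub>grp A\<^esub> x = \<one>\<^bsub>grp A\<^esub>"
      using x cl[of SMinus] neg by (auto intro!: bexI[of _ "interp A SMinus [x]"])
  qed (use cl[of SZero] in simp)
  interpret comm_group "grp A" by (rule cg)
  show "interp A SMinus [x] = inv\<^bsub>grp A\<^esub> x" if "x \<in> carrier A" for x
    using that neg cl[of SMinus] by (intro inv_equality[symmetric]) auto
  fix n :: nat and x assume n: "0 < n" "x \<in> carrier A"
  have in_axioms: "(multiple n (App (SDiv n) [Var 0]), Var 0) \<in> DAG_axioms"
    "(App (SDiv n) [multiple n (Var 0)], Var 0) \<in> DAG_axioms"
    using n by (auto simp: DAG_axioms_def Let_def)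
  show "interp A (SDiv n) [x] [^]\<^bsub>grp A\<^esub> n = x"
    using ax[of "multiple n (App (SDiv n) [Var 0])" "Var 0" x x x] n in_axioms
    by (simp add: eval_multiple)
  show "interp A (SDiv n) [x [^]\<^bsub>grp A\<^esub> n] = x"
    using ax[of "App (SDiv n) [multiple n (Var 0)]" "Var 0" x x x] n in_axioms
    by (simp add: eval_multiple)
qed

lemma grp_reduct [simp]: "grp (reduct AG_lang A) = grp A"
  by (simp add: grp_def reduct_def dom_def)

lemma carrier_reduct [simp]: "carrier (reduct L A) = carrier A"
  by (simp add: reduct_def)

text \<open>In the torsion-free step, \<open>x = d\<^sub>n(n x) = d\<^sub>n(0) = d\<^sub>n(n 0) = 0\<close>.\<close>

lemma reduct_in_TFAG:
  assumes A: "A \<in> models DAG_lang DAG_axioms"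
  shows "reduct AG_lang A \<in> TFAG"
proof -
  note ax = models_DAG_axiomsD[OF A]
  interpret comm_group "grp A" by (rule ax)
  have "x = \<one>\<^bsub>grp A\<^esub>"
    if "x \<in> carrier A" "0 < n" "x [^]\<^bsub>grp A\<^esub> n = \<one>\<^bsub>grp A\<^esub>" for x and n :: nat
    using ax(5)[OF that(2), of x] ax(5)[OF that(2), of "\<one>\<^bsub>grp A\<^esub>"] that one_closed nat_pow_one[of n]
    by simp
  moreover have "interp (reduct AG_lang A) SMinus = interp A SMinus"
    by (simp add: reduct_def dom_def)
  ultimately show ?thesis
    using is_alg_reduct[OF ax(1) AG_lang_le_DAG_lang] ax(2,3)
    unfolding TFAG_def by (simp only: mem_Collect_eq grp_reduct carrier_reduct) auto
qed

lemma divide_by_reduct: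
  assumes A: "A \<in> models DAG_lang DAG_axioms" and n: "0 < n" and x: "x \<in> carrier A"
  shows "divide_by n (reduct AG_lang A) [x] = Some (interp A (SDiv n) [x])"
  using models_DAG_axiomsD(4)[OF A n x] is_algD[OF models_DAG_axiomsD(1)[OF A], of "SDiv n" 1 "[x]"]
    reduct_in_TFAG[OF A] n x
  by (simp add: divide_by_eq_Some[OF n])

text \<open>
  Equality, not just isomorphism, because interpretations are normalized off their domain.
\<close>

lemma expand_reduct:
  assumes A: "A \<in> models DAG_lang DAG_axioms"
  shows "expand_alg div_symbols (reduct AG_lang A) = A"
proof -
  have alg: "is_alg DAG_lang A" by (rule models_DAG_axiomsD[OF A])
  have "interp (expand_alg div_symbols (reduct AG_lang A)) s = interp A s" for s
  proof (cases s)
    case (SDiv n)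
    show ?thesis
    proof (cases "0 < n")
      case True
      have "interp (expand_alg div_symbols (reduct AG_lang A)) s xs = interp A s xs" for xs
        using True SDiv divide_by_reduct[OF A True] is_alg_undefined[OF alg, of s 1 xs]
        by (cases "xs \<in> tuples 1 (carrier A)") (auto simp: expand_alg_def)
      then show ?thesis by blast
    next
      case False
      then have "interp A s xs = undefined" for xs
        using SDiv is_alg_undefined[OF alg, of s] by simp
      with False SDiv show ?thesis by (auto simp: expand_alg_def reduct_def)
    qed
  qed (auto simp: expand_alg_def reduct_def dom_def)
  then show ?thesis
    by (intro ualg.equality) (auto simp: expand_alg_def)
qed

text \<open>
  On a group where all divisions are total, \<open>n d\<^sub>n(x) = x\<close> holds by definition of division, and
  \<open>d\<^sub>n(n x) = x\<close> by uniqueness of quotients.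
\<close>

lemma expand_in_models:
  assumes A: "A \<in> TFAG" and total: "\<And>n. 0 < n \<Longrightarrow> dom (divide_by n A) = tuples 1 (carrier A)"
  shows "expand_alg div_symbols A \<in> models DAG_lang DAG_axioms"
proof -
  let ?B = "expand_alg div_symbols A"
  interpret comm_group "grp A" by (rule TFAG_group[OF A])
  have car [simp]: "carrier ?B = carrier A" by (simp add: expand_alg_def)
  have op [simp]: "interp ?B SPlus = interp A SPlus" "interp ?B SMinus = interp A SMinus"
    "interp ?B SZero = interp A SZero"
    by (simp_all add: expand_alg_def)
  have grp [simp]: "grp ?B = grp A" by (simp add: grp_def)
  have div: "interp ?B (SDiv n) [x] \<in> carrier A \<and> interp ?B (SDiv n) [x] [^]\<^bsub>grp A\<^esub> n = x"
    if "0 < n" "x \<in> carrier A" for n x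
  proof -
    from that total[OF that(1)] obtain b where b: "divide_by n A [x] = Some b"
      by (metis domD tuples_simps(2))
    with that have "interp ?B (SDiv n) [x] = b" by (simp add: expand_alg_def)
    with b show ?thesis by (simp add: divide_by_eq_Some[OF that(1)])
  qed
  have div_multiple: "interp ?B (SDiv n) [x [^]\<^bsub>grp A\<^esub> n] = x" if "0 < n" "x \<in> carrier A" for n x
    using div[OF that(1), of "x [^]\<^bsub>grp A\<^esub> n"] nat_pow_closed[of x n] that TFAG_pow_inj[OF A that(1)]
    by auto
  have alg: "is_alg DAG_lang ?B"
    unfolding is_alg_def
  proof (intro conjI allI)
    show "carrier ?B \<noteq> {}" using TFAG_group(1)[OF A] by (simp add: is_alg_def)
    fix s
    have old: "case AG_lang s of Some n \<Rightarrow> interp A s \<in> tuples n (carrier A) \<rightarrow>\<^sub>E carrier A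
      | None \<Rightarrow> interp A s = (\<lambda>_. undefined)"
      using TFAG_group(1)[OF A] unfolding is_alg_def by blast
    show "case DAG_lang s of Some n \<Rightarrow> interp ?B s \<in> tuples n (carrier ?B) \<rightarrow>\<^sub>E carrier ?B
      | None \<Rightarrow> interp ?B s = (\<lambda>_. undefined)"
    proof (cases s)
      case (SDiv n)
      show ?thesis
      proof (cases "0 < n")
        case True
        have "interp ?B s = restrict (interp ?B s) (tuples 1 (carrier A))"
          using True SDiv by (simp add: expand_alg_def)
        moreover have "restrict (interp ?B s) (tuples 1 (carrier A)) \<in> tuples 1 (carrier A) \<rightarrow>\<^sub>E carrier A"
          using True SDiv div by auto
        ultimately show ?thesis using True SDiv by simp
      next
        case False
        with SDiv old show ?thesis by (simp add: expand_alg_def)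
      qed
    qed (use old in auto)
  qed
  have "eval ?B e s = eval ?B e t" if "(s, t) \<in> DAG_axioms" "\<forall>i. e i \<in> carrier A" for s t e
  proof -
    have e: "e i \<in> carrier A" for i using that(2) by auto
    show ?thesis
      using that(1) m_assoc[of "e 0" "e 1" "e 2"] m_comm[of "e 0" "e 1"] l_one[of "e 0"] l_inv[of "e 0"]
        e div div_multiple TFAG_group(3)[OF A, of "e 0"]
      by (auto simp: DAG_axioms_def Let_def eval_multiple)
  qed
  with alg show ?thesis by (auto simp: models_def)
qed

text \<open>
  An equational class is closed under isomorphic copies of subalgebras, so it contains \<open>DAG\<close> as soon
  as it contains the expansions. Conversely a model is itself the expansion of its group reduct.
\<close>

theorem DAG_eq_models: "DAG = models DAG_lang DAG_axioms"
proof (intro equalityI subsetI)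
  fix A :: "('a, sym) ualg" assume "A \<in> DAG"
  then obtain B C :: "('a, sym) ualg" and h where A: "is_alg DAG_lang A" and B: "B \<in> expand_class div_symbols TFAG"
    and C: "subalgebra DAG_lang C B" and h: "alg_iso DAG_lang A C h"
    unfolding DAG_def subalgs_def by blast
  from B obtain A' :: "('a, sym) ualg" where A': "B = expand_alg div_symbols A'" "A' \<in> TFAG"
    and total: "\<forall>(n, f)\<in>ran div_symbols. dom (f A') = tuples n (carrier A')"
    unfolding expand_class_def by blast
  have "dom (divide_by n A') = tuples 1 (carrier A')" if "0 < n" for n
  proof -
    from that have "(1, divide_by n) \<in> ran div_symbols"
      unfolding ran_div_symbols by blast
    from bspec[OF total this] show ?thesis by (simp only: prod.case)
  qed
  with A' have "B \<in> models DAG_lang DAG_axioms"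
    by (simp only: expand_in_models)
  with C have "C \<in> models DAG_lang DAG_axioms"
    using variety_models[OF is_trm_DAG_axioms] unfolding variety_def by blast
  then show "A \<in> models DAG_lang DAG_axioms"
    by (rule models_embedding[OF is_trm_DAG_axioms _ A, where h = h])
      (use h in \<open>simp_all add: alg_iso_def bij_betw_def\<close>)
next
  fix A :: "('a, sym) ualg" assume A: "A \<in> models DAG_lang DAG_axioms"
  have "dom (divide_by n (reduct AG_lang A)) = tuples 1 (carrier A)" if "0 < n" for n
  proof (intro equalityI subsetI)
    fix xs assume "xs \<in> dom (divide_by n (reduct AG_lang A))"
    then show "xs \<in> tuples 1 (carrier A)"
      using defined_by_division_fm[OF that] reduct_in_TFAG[OF A]
      by (fastforce simp: defined_by_def pfun_on_def)
  qed (auto simp: divide_by_reduct[OF A that] dom_def)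
  then have "\<forall>(n, f)\<in>ran div_symbols.
      dom (f (reduct AG_lang A)) = tuples n (carrier (reduct AG_lang A))"
    unfolding ran_div_symbols by (intro ballI) (elim CollectE exE conjE, simp)
  then have "expand_alg div_symbols (reduct AG_lang A) \<in> expand_class div_symbols TFAG"
    unfolding expand_class_def using reduct_in_TFAG[OF A] by blast
  then have "A \<in> expand_class div_symbols TFAG"
    unfolding expand_reduct[OF A] .
  moreover have "is_alg DAG_lang A" by (rule models_DAG_axiomsD[OF A])
  moreover from this have "subalgebra DAG_lang A A" "alg_iso DAG_lang A A id"
    by (auto simp: subalgebra_def alg_iso_def alg_hom_def)
  ultimately show "A \<in> DAG"
    unfolding DAG_def subalgs_def by blast
qed


section \<open>Implicit operations take values in the generated subalgebra\<close>

text \<open>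
  A quotient of a divisible torsion-free group by a subgroup closed under division is again
  torsion-free: as division commutes with subtraction, such a subgroup defines a congruence in the
  language with division, and the quotient lies in the variety.
\<close>

lemma quotient_of_DAG:
  fixes A :: "('a, sym) ualg"
  assumes A: "A \<in> DAG" and V: "subgroup V (grp A)"
    and V_div: "\<And>n x. 0 < n \<Longrightarrow> x \<in> V \<Longrightarrow> interp A (SDiv n) [x] \<in> V"
  obtains B :: "('a, sym) ualg" and r where "B \<in> DAG" "alg_hom DAG_lang A B r"
    "\<And>x. x \<in> carrier A \<Longrightarrow> r x = interp B SZero [] \<longleftrightarrow> x \<in> V"
proof -
  note A' = A[unfolded DAG_eq_models]
  note ax = models_DAG_axiomsD[OF A']
  interpret comm_group "grp A" by (rule ax)
  interpret V: subgroup V "grp A" by (rule V)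
  have car [simp]: "carrier A = carrier (grp A)" by simp
  note [simp del] = grp_simps
  note sym = grp_simps(2,3)[of A, symmetric]
  define R where "R x y \<longleftrightarrow> x \<in> carrier (grp A) \<and> y \<in> carrier (grp A) \<and> x \<otimes>\<^bsub>grp A\<^esub> inv\<^bsub>grp A\<^esub> y \<in> V" for x y
  have R_refl: "R x x" if "x \<in> carrier A" for x
    using that by (simp add: R_def)
  have R_sym: "R y x" if "R x y" for x y
  proof -
    have "inv\<^bsub>grp A\<^esub> (x \<otimes>\<^bsub>grp A\<^esub> inv\<^bsub>grp A\<^esub> y) = y \<otimes>\<^bsub>grp A\<^esub> inv\<^bsub>grp A\<^esub> x"
      using that by (simp add: R_def inv_mult_group)
    with that show ?thesis unfolding R_def by (metis V.m_inv_closed)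
  qed
  have R_plus: "R (x \<otimes>\<^bsub>grp A\<^esub> x') (y \<otimes>\<^bsub>grp A\<^esub> y')" if "R x y" "R x' y'" for x x' y y'
  proof -
    have "(x \<otimes>\<^bsub>grp A\<^esub> inv\<^bsub>grp A\<^esub> y) \<otimes>\<^bsub>grp A\<^esub> (x' \<otimes>\<^bsub>grp A\<^esub> inv\<^bsub>grp A\<^esub> y')
        = (x \<otimes>\<^bsub>grp A\<^esub> x') \<otimes>\<^bsub>grp A\<^esub> inv\<^bsub>grp A\<^esub> (y \<otimes>\<^bsub>grp A\<^esub> y')"
      using that by (simp add: R_def inv_mult m_ac)
    moreover have "x \<otimes>\<^bsub>grp A\<^esub> x' \<in> carrier (grp A)" "y \<otimes>\<^bsub>grp A\<^esub> y' \<in> carrier (grp A)"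
      using that m_closed by (simp_all add: R_def)
    ultimately show ?thesis using that unfolding R_def by (metis V.m_closed)
  qed
  have R_trans: "R x z" if "R x y" "R y z" for x y z
  proof -
    have "(x \<otimes>\<^bsub>grp A\<^esub> inv\<^bsub>grp A\<^esub> y) \<otimes>\<^bsub>grp A\<^esub> (y \<otimes>\<^bsub>grp A\<^esub> inv\<^bsub>grp A\<^esub> z)
        = x \<otimes>\<^bsub>grp A\<^esub> inv\<^bsub>grp A\<^esub> z"
      using that by (simp add: R_def m_assoc inv_solve_left')
    with that show ?thesis unfolding R_def by (metis V.m_closed)
  qed
  have R_minus: "R (inv\<^bsub>grp A\<^esub> x) (inv\<^bsub>grp A\<^esub> y)" if "R x y" for x y
  proof -
    have "inv\<^bsub>grp A\<^esub> x \<otimes>\<^bsub>grp A\<^esub> inv\<^bsub>grp A\<^esub> (inv\<^bsub>grp A\<^esub> y) = y \<otimes>\<^bsub>grp A\<^esub> inv\<^bsub>grp A\<^esub> x"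
      using that by (simp add: R_def m_comm)
    moreover have "inv\<^bsub>grp A\<^esub> x \<in> carrier A" "inv\<^bsub>grp A\<^esub> y \<in> carrier A"
      using that inv_closed by (simp_all add: R_def)
    ultimately show ?thesis using R_sym[OF that] by (simp add: R_def)
  qed
  have div_closed: "interp A (SDiv n) [x] \<in> carrier A" if "0 < n" "x \<in> carrier A" for n x
    using is_algD[OF ax(1), of "SDiv n" 1 "[x]"] that by simp
  have R_div: "R (interp A (SDiv n) [x]) (interp A (SDiv n) [y])" if n: "0 < n" and R: "R x y" for n x y
  proof -
    let ?d = "\<lambda>x. interp A (SDiv n) [x]"
    have xy: "x \<in> carrier A" "y \<in> carrier A" using R by (simp_all add: R_def)
    note d = div_closed[OF n xy(1)] div_closed[OF n xy(2)]
    have z: "?d x \<otimes>\<^bsub>grp A\<^esub> inv\<^bsub>grp A\<^esub> (?d y) \<in> carrier A"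
      using d m_closed inv_closed by simp
    \<comment> \<open>Multiplying by \<open>n\<close> shows that \<open>d\<^sub>n(x) - d\<^sub>n(y) = d\<^sub>n(x - y)\<close>.\<close>
    have "(?d x \<otimes>\<^bsub>grp A\<^esub> inv\<^bsub>grp A\<^esub> (?d y)) [^]\<^bsub>grp A\<^esub> n = x \<otimes>\<^bsub>grp A\<^esub> inv\<^bsub>grp A\<^esub> y"
      using d ax(4)[OF n xy(1)] ax(4)[OF n xy(2)] by (simp add: nat_pow_distrib nat_pow_inv)
    with ax(5)[OF n z] have "?d x \<otimes>\<^bsub>grp A\<^esub> inv\<^bsub>grp A\<^esub> (?d y) = ?d (x \<otimes>\<^bsub>grp A\<^esub> inv\<^bsub>grp A\<^esub> y)"
      by simp
    with R d V_div[OF n] show ?thesis by (simp add: R_def)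
  qed
  \<comment> \<open>Related elements satisfy the same predicate \<open>R x\<close>, so they get the same representative.\<close>
  define r where "r x = (SOME y. R x y)" for x
  have r: "R x (r x)" if "x \<in> carrier A" for x
    unfolding r_def by (rule someI[of "R x"], rule R_refl[OF that])
  have r_eq: "r x = r y \<longleftrightarrow> R x y" if "x \<in> carrier A" "y \<in> carrier A" for x y
  proof
    assume "R x y"
    then have "R x = R y" using R_sym R_trans by blast
    then show "r x = r y" by (simp add: r_def)
  next
    assume "r x = r y"
    then show "R x y" using r[OF that(1)] r[OF that(2)] R_sym R_trans by metis
  qed
  have r_car: "r x \<in> carrier A" if "x \<in> carrier A" for x
    using r[OF that] by (simp add: R_def)
  have "r (interp A s (map r xs)) = r (interp A s xs)"
    if s: "DAG_lang s = Some n" and xs: "xs \<in> tuples n (carrier A)" for s n xs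
  proof -
    have "R (interp A s (map r xs)) (interp A s xs)"
    proof (cases s)
      case SPlus
      with s xs obtain x y where "xs = [x, y]" "x \<in> carrier A" "y \<in> carrier A" by auto
      with SPlus R_plus[OF R_sym[OF r] R_sym[OF r], of x y] show ?thesis by (simp add: sym)
    next
      case SMinus
      with s xs obtain x where "xs = [x]" "x \<in> carrier A" by auto
      with SMinus R_minus[OF R_sym[OF r], of x] r_car show ?thesis by (simp add: ax(3))
    next
      case SZero
      with s xs show ?thesis using R_refl is_algD[OF ax(1), of SZero] by simp
    next
      case (SDiv k)
      with s xs have k: "0 < k" and "n = 1" by (auto split: if_splits)
      with xs obtain x where "xs = [x]" "x \<in> carrier A" by auto
      with SDiv R_div[OF k R_sym[OF r], of x] show ?thesis by simp
    qed
    moreover from this have "interp A s (map r xs) \<in> carrier A" "interp A s xs \<in> carrier A"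
      by (simp_all add: R_def)
    ultimately show ?thesis by (rule iffD2[OF r_eq, rotated 2])
  qed
  moreover have "r \<in> carrier A \<rightarrow> carrier A" using r_car by auto
  ultimately obtain B where B: "is_alg DAG_lang B" "carrier B = r ` carrier A" "alg_hom DAG_lang A B r"
    using quotient_by_representatives[OF ax(1)] by metis
  have "B \<in> DAG"
    unfolding DAG_eq_models using models_image[OF is_trm_DAG_axioms A' B(1,3)] B(2) by simp
  moreover have "r x = interp B SZero [] \<longleftrightarrow> x \<in> V" if "x \<in> carrier A" for x
  proof -
    have "interp B SZero [] = r \<one>\<^bsub>grp A\<^esub>"
      using alg_homD[OF B(3), of SZero 0 "[]"] by (simp add: sym)
    then show ?thesis
      using r_eq[OF that, of "\<one>\<^bsub>grp A\<^esub>"] that one_closed by (simp add: R_def)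
  qed
  ultimately show thesis using B(3) that by blast
qed

text \<open>The zero map is a homomorphism from any algebra whatsoever, as \<open>{0}\<close> is a subgroup.\<close>

lemma zero_hom:
  assumes B: "B \<in> TFAG"
  shows "alg_hom AG_lang A B (\<lambda>_. interp B SZero [])"
proof -
  interpret comm_group "grp B" by (rule TFAG_group[OF B])
  have "interp B s (map (\<lambda>_. interp B SZero []) xs) = interp B SZero []"
    if "AG_lang s = Some n" "xs \<in> tuples n (carrier A)" for s n xs
  proof (cases s)
    case SPlus
    with that l_one[OF one_closed] show ?thesis by auto
  next
    case SMinus
    have "inv\<^bsub>grp B\<^esub> interp B SZero [] = interp B SZero []"
      using inv_one unfolding grp_simps .
    with that SMinus TFAG_group(3)[OF B, of "interp B SZero []"] one_closed show ?thesis by auto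
  qed (use that in auto)
  then show ?thesis using one_closed by (auto simp: alg_hom_def)
qed

text \<open>
  The values at \<open>xs\<close> of the terms form a subgroup closed under division. The quotient map and the
  zero map agree on \<open>xs\<close>, so they also agree on the value at \<open>xs\<close> of any partial function that
  homomorphisms preserve; hence this value lies in the kernel of the quotient map.
\<close>

lemma implicit_operation_value_is_term_value:
  assumes f: "implicit_operation AG_lang TFAG (n, f)" and A: "A \<in> DAG"
    and b: "f (reduct AG_lang A) xs = Some b"
  shows "\<exists>t. is_trm DAG_lang t \<and> vars t \<subseteq> {..<n} \<and> b = eval A ((!) xs) t"
proof -
  note ax = models_DAG_axiomsD[OF A[unfolded DAG_eq_models]]
  have reduct: "reduct AG_lang C \<in> TFAG" if "C \<in> DAG" for C :: "('a, sym) ualg"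
    using that unfolding DAG_eq_models by (rule reduct_in_TFAG)
  from f have "pfun_on TFAG (n, f)" and hom: "hom_preserved AG_lang TFAG (n, f)"
    by (auto simp: implicit_operation_def defined_by_def)
  with reduct[OF A] b have xs: "xs \<in> tuples n (carrier A)" and b_car: "b \<in> carrier A"
    by (fastforce simp: pfun_on_def ran_def)+
  define V where "V = eval A ((!) xs) ` {t. is_trm DAG_lang t \<and> vars t \<subseteq> {..<n}}"
  have V_op: "interp A s vs \<in> V" if s: "DAG_lang s = Some k" and "vs \<in> tuples k V" for s k vs
  proof -
    from that(2) obtain ts where ts: "ts \<in> tuples k {t. is_trm DAG_lang t \<and> vars t \<subseteq> {..<n}}"
      "vs = map (eval A ((!) xs)) ts"
      by (auto simp: V_def tuples_image)
    then have "is_trm DAG_lang (App s ts)" "vars (App s ts) \<subseteq> {..<n}"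
      using s by (auto simp: tuples_def list_all_iff)
    then show ?thesis
      unfolding V_def using ts(2) by (intro image_eqI[of _ _ "App s ts"]) auto
  qed
  have V_sub: "V \<subseteq> carrier A"
    using xs nth_mem[of _ xs] unfolding V_def
    by (fastforce simp: tuples_def intro!: eval_closed[OF ax(1)])
  have "subgroup V (grp A)"
  proof
    fix x assume "x \<in> V"
    then show "inv\<^bsub>grp A\<^esub> x \<in> V"
      using V_op[of SMinus 1 "[x]"] ax(3)[of x] V_sub by auto
  qed (use V_sub V_op[of SPlus 2] V_op[of SZero 0 "[]"] in auto)
  moreover have "interp A (SDiv m) [x] \<in> V" if "0 < m" "x \<in> V" for m x
    using V_op[of "SDiv m" 1 "[x]"] that by simp
  ultimately obtain B :: "('a, sym) ualg" and r where B: "B \<in> DAG" "alg_hom DAG_lang A B r"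
    and ker: "\<And>x. x \<in> carrier A \<Longrightarrow> r x = interp B SZero [] \<longleftrightarrow> x \<in> V"
    using quotient_of_DAG[OF A] by blast
  define z where "z = interp B SZero []"
  have "x \<in> V" if x: "x \<in> set xs" for x
  proof -
    from x obtain i where "i < length xs" "x = xs ! i" by (auto simp: in_set_conv_nth)
    with xs show ?thesis
      unfolding V_def by (intro image_eqI[of _ _ "Var i"]) (auto simp: tuples_def)
  qed
  with ker xs have agree: "map r xs = map (\<lambda>_. z) xs"
    by (auto simp: z_def tuples_def)
  have "f (reduct AG_lang B) (map r xs) = Some (r b)"
    using hom reduct[OF A] reduct[OF B(1)] alg_hom_reduct[OF B(2) AG_lang_le_DAG_lang] b
    unfolding hom_preserved_def by blast
  moreover have "f (reduct AG_lang B) (map (\<lambda>_. z) xs) = Some z"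
  proof -
    have "interp (reduct AG_lang B) SZero [] = z" by (simp add: z_def reduct_def dom_def)
    then have "alg_hom AG_lang (reduct AG_lang A) (reduct AG_lang B) (\<lambda>_. z)"
      using zero_hom[OF reduct[OF B(1)], of "reduct AG_lang A"] by simp
    with hom reduct[OF A] reduct[OF B(1)] b show ?thesis
      unfolding hom_preserved_def by blast
  qed
  ultimately have "r b = z" unfolding agree by simp
  with ker b_car have "b \<in> V" by (simp add: z_def)
  then show ?thesis by (auto simp: V_def)
qed

theorem theorem13p10:
  assumes "infinite (UNIV :: 'a set)"
  shows "variety DAG_lang (DAG :: ('a, sym) ualg set) (DAG :: ('b, sym) ualg set)
           (DAG :: ('i \<Rightarrow> 'a, sym) ualg set) \<and>
         equational_Beth_companion AG_lang (TFAG :: ('a, sym) ualg set)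
           DAG_lang (DAG :: ('a, sym) ualg set)"
proof
  show "variety DAG_lang (DAG :: ('a, sym) ualg set) (DAG :: ('b, sym) ualg set)
      (DAG :: ('i \<Rightarrow> 'a, sym) ualg set)"
    unfolding DAG_eq_models by (rule variety_models[OF is_trm_DAG_axioms])
  have "induced_by AG_lang TFAG (ran div_symbols) DAG_lang (DAG :: ('a, sym) ualg set)"
    unfolding induced_by_def DAG_def
    using expansion_symbols_div_symbols[OF assms] expansion_lang_div_symbols by metis
  moreover have "ran div_symbols \<subseteq> ext_eq AG_lang (TFAG :: ('a, sym) ualg set)"
    using divide_by_ext_eq by (auto simp: ran_div_symbols)
  ultimately have eq: "equational_expansion AG_lang TFAG DAG_lang (DAG :: ('a, sym) ualg set)"
    unfolding equational_expansion_def by blast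
  then have "pp_expansion AG_lang TFAG DAG_lang (DAG :: ('a, sym) ualg set)"
    unfolding equational_expansion_def pp_expansion_def using ext_eq_subset_ext_pp by blast
  moreover have "\<exists>T \<subseteq> {t. is_trm DAG_lang t \<and> vars t \<subseteq> {..<n}}.
      \<forall>A\<in>(DAG :: ('a, sym) ualg set). \<forall>xs\<in>dom (f (reduct AG_lang A)).
        \<exists>t\<in>T. f (reduct AG_lang A) xs = Some (eval A ((!) xs) t)"
    if "implicit_operation AG_lang TFAG (n, f)" for n f
    using implicit_operation_value_is_term_value[OF that]
    by (intro exI[of _ "{t. is_trm DAG_lang t \<and> vars t \<subseteq> {..<n}}"]) fastforce
  ultimately show "equational_Beth_companion AG_lang (TFAG :: ('a, sym) ualg set)
      DAG_lang (DAG :: ('a, sym) ualg set)"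
    using eq by (simp add: equational_Beth_companion_def Beth_companion_def)
qed

end
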